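(* For nonnegative integers $m<n$ and an integer $k\ge 1$, let $\Phi_k(m,n)$ denote the number of subsets $A$ of $\{m+1,m+2,\ldots,n\}$ with $\mathrm{card}(A)=k$ such that $\gcd(A)$ is relatively prime to $n$. Then \[ \Phi_k(m,n)=\sum_{d\mid n}\mu(d)\binom{n/d-[m/d]}{k}. \] Moreover, if $n\ge 2$ and $p^{*}$ is the smallest prime divisor of $n$, then \[ 0\le \binom{n-m}{k}-\binom{n/p^{*}-[m/p^{*}]}{k}-\Phi_k(m,n)\le n\binom{[(n-m)/(p^{*}+1)]+1}{k}. \]
   Context: $\mu$ denotes the Möbius function, and the sum runs over positive divisors $d$ of $n$. For a real number $x$, $[x]$ denotes the greatest integer not exceeding $x$. Binomial coefficients $\binom{a}{k}$ with integers $0\le a<k$ are equal to $0$. *)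

theory Defs
  imports "HOL-Number_Theory.Number_Theory" "HOL-Computational_Algebra.Squarefree"
begin

definition moebius_mu :: "nat \<Rightarrow> int" where
  "moebius_mu n = (if squarefree n then (-1) ^ card (prime_factors n) else 0)"

definition Phi :: "nat \<Rightarrow> nat \<Rightarrow> nat \<Rightarrow> nat" where
  "Phi k m n = card {A. A \<subseteq> {m+1..n} \<and> card A = k \<and> coprime (Gcd A) n}"

definition least_prime_divisor :: "nat \<Rightarrow> nat" where
  "least_prime_divisor n = (LEAST p. prime p \<and> p dvd n)"

end

theory Submission
  imports Defs
begin

text \<open>The formula comes from replacing the condition that \<open>gcd(A)\<close> be coprime to \<open>n\<close> by the sum
  of \<open>\<mu>(d)\<close> over the common divisors \<open>d\<close> of \<open>gcd(A)\<close> and \<open>n\<close>, and exchanging the order of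
  summation: the \<open>k\<close>-subsets all of whose members are divisible by \<open>d\<close> are the \<open>k\<close>-subsets of the
  multiples of \<open>d\<close> in \<open>(m, n]\<close>. For the estimate, the middle expression counts the \<open>k\<close>-subsets
  whose gcd is not coprime to \<open>n\<close> and that do not consist of multiples of \<open>p\<^sup>*\<close>. Each of them
  consists of multiples of some prime divisor \<open>q \<ge> p\<^sup>* + 1\<close> of \<open>n\<close>, and there are at most \<open>n\<close>
  such primes.\<close>

text \<open>Together with \<open>prod_prime_factors_squarefree\<close>, this makes
  \<open>prime_factors\<close> and the product mutually inverse between squarefree numbers and
  finite sets of primes.\<close>

lemma prime_factors_prod_primes:
  fixes A :: "nat set"
  assumes "finite A" "\<And>p. p \<in> A \<Longrightarrow> prime p"
  shows "prime_factors (\<Prod>A) = A"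
proof -
  have "prime_factors (\<Prod>A) = (\<Union>p\<in>A. prime_factors p)"
    using assms by (subst prime_factors_prod) (auto dest: prime_gt_0_nat)
  also have "\<dots> = A"
    using assms(2) by (auto simp: prime_prime_factors)
  finally show ?thesis .
qed

lemma prod_prime_factors_squarefree:
  fixes d :: nat
  assumes "squarefree d"
  shows "\<Prod>(prime_factors d) = d"
proof -
  have d0: "d \<noteq> 0" using assms by (auto intro: ccontr)
  have "d = (\<Prod>p\<in>prime_factors d. p ^ multiplicity p d)"
    using d0 prime_factorization_nat by blast
  also have "\<dots> = \<Prod>(prime_factors d)"
    using assms squarefree_factorial_semiring'[OF d0]
    by (intro prod.cong) simp_all
  finally show ?thesis by simp
qed

lemma squarefree_prod_primes:
  fixes A :: "nat set"
  assumes "\<And>p. p \<in> A \<Longrightarrow> prime p"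
  shows "squarefree (\<Prod>A)"
  using assms by (intro squarefree_prod_coprime) (auto intro: primes_coprime squarefree_prime)

text \<open>Expand the product of \<open>-1 + 1\<close> over \<open>A\<close>, which is
  \<open>0 ^ card A\<close>: choosing \<open>-1\<close> exactly on \<open>B\<close> contributes
  \<open>(-1) ^ card B\<close>.\<close>

lemma sum_Pow_minus_one_card:
  assumes "finite A"
  shows "(\<Sum>B\<in>Pow A. (-1) ^ card B) = (if A = {} then 1 else (0 :: int))"
  using prod_add[OF assms, of "\<lambda>_. -1 :: int" "\<lambda>_. 1"] assms
  by (simp add: card_eq_0_iff power_0_left)

text \<open>Only squarefree divisors contribute, and they correspond to the subsets of
  \<open>prime_factors n\<close>; the signed count of these subsets cancels unless \<open>n\<close>
  has no prime factor.\<close>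

lemma sum_moebius_mu_divisors:
  assumes "n > 0"
  shows "(\<Sum>d | d dvd n. moebius_mu d) = (if n = 1 then 1 else 0)"
proof -
  have "(\<Sum>d | d dvd n. moebius_mu d) = (\<Sum>d | d dvd n \<and> squarefree d. (-1) ^ card (prime_factors d))"
    using assms by (intro sum.mono_neutral_cong_right) (auto simp: moebius_mu_def)
  also have "\<dots> = (\<Sum>B\<in>Pow (prime_factors n). (-1) ^ card B)"
  proof (rule sum.reindex_bij_witness[where i = "\<lambda>B. \<Prod>B" and j = prime_factors], goal_cases)
    case (1 d)
    then show ?case by (simp add: prod_prime_factors_squarefree)
  next
    case (2 d)
    then show ?case using assms by (simp add: dvd_prime_factors)
  next
    case (3 B)
    then show ?case
      by (intro prime_factors_prod_primes) (auto intro: finite_subset)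
  next
    case (4 B)
    \<comment> \<open>The radical of \<open>n\<close> is the intermediate term; it divides
      \<open>n\<close> because every prime factor has positive multiplicity.\<close>
    have "\<Prod>B dvd \<Prod>(prime_factors n)"
      using 4 by (intro prod_dvd_prod_subset) auto
    also have "\<dots> dvd (\<Prod>p\<in>prime_factors n. p ^ multiplicity p n)"
      by (intro prod_dvd_prod dvd_power) (auto simp: prime_factors_multiplicity)
    also have "\<dots> = n"
      using assms prime_factorization_nat by simp
    finally show ?case
      using 4 by (auto intro!: squarefree_prod_primes)
  qed simp
  also have "\<dots> = (if prime_factors n = {} then 1 else 0)"
    by (rule sum_Pow_minus_one_card) simp
  also have "prime_factors n = {} \<longleftrightarrow> n = 1"
    using assms by (auto simp: prime_factorization_empty_iff)
  finally show ?thesis .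
qed

lemma card_multiples_atLeastAtMost:
  fixes d m n :: nat
  assumes "d > 0"
  shows "card {x \<in> {m+1..n}. d dvd x} = n div d - m div d"
proof -
  have "{x \<in> {m+1..n}. d dvd x} = (\<lambda>i. d * i) ` {m div d + 1..n div d}"
  proof (intro equalityI subsetI)
    fix x assume "x \<in> {x \<in> {m+1..n}. d dvd x}"
    then obtain i where "x = d * i" "m < d * i" "d * i \<le> n" by auto
    then show "x \<in> (\<lambda>i. d * i) ` {m div d + 1..n div d}"
      using assms by (auto simp: Suc_le_eq div_less_iff_less_mult less_eq_div_iff_mult_less_eq mult.commute)
  next
    fix x assume "x \<in> (\<lambda>i. d * i) ` {m div d + 1..n div d}"
    then show "x \<in> {x \<in> {m+1..n}. d dvd x}"
      using assms by (auto simp: Suc_le_eq div_less_iff_less_mult less_eq_div_iff_mult_less_eq mult.commute)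
  qed
  then show ?thesis
    using assms by (simp add: card_image inj_on_def)
qed

definition ksubsets :: "nat \<Rightarrow> nat \<Rightarrow> nat \<Rightarrow> nat set set" where
  "ksubsets k m n = {A. A \<subseteq> {m+1..n} \<and> card A = k}"

lemma finite_ksubsets [simp]: "finite (ksubsets k m n)"
  by (rule finite_subset[of _ "Pow {m+1..n}"]) (auto simp: ksubsets_def)

lemma card_ksubsets: "card (ksubsets k m n) = (n - m) choose k"
  by (simp add: ksubsets_def n_subsets)

lemma card_ksubsets_dvd_Gcd:
  assumes "d > 0"
  shows "card {A \<in> ksubsets k m n. d dvd Gcd A} = (n div d - m div d) choose k"
proof -
  \<comment> \<open>For \<open>k = 0\<close> this still fits: \<open>Gcd {} = 0\<close> is divisible
    by every \<open>d\<close>.\<close>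
  have "{A \<in> ksubsets k m n. d dvd Gcd A} = {A. A \<subseteq> {x \<in> {m+1..n}. d dvd x} \<and> card A = k}"
    by (auto simp: ksubsets_def dvd_Gcd_iff)
  then show ?thesis
    using n_subsets[of "{x \<in> {m+1..n}. d dvd x}" k] card_multiples_atLeastAtMost[OF assms]
    by simp
qed

lemma Phi_eq_card_coprime_Gcd: "Phi k m n = card {A \<in> ksubsets k m n. coprime (Gcd A) n}"
  by (simp add: Phi_def ksubsets_def)

lemma Phi_eq_sum_moebius_mu:
  assumes "n > 0"
  shows "int (Phi k m n) = (\<Sum>d | d dvd n. moebius_mu d * int ((n div d - m div d) choose k))"
proof -
  \<comment> \<open>The sum over divisors of \<open>gcd g n\<close> is spread over all divisors of
    \<open>n\<close>, so that its index set no longer depends on \<open>g\<close> and the two sums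
    can be swapped.\<close>
  have coprime_sum: "(if coprime g n then 1 else 0) = (\<Sum>d | d dvd n. if d dvd g then moebius_mu d else 0)"
    for g
  proof -
    have "(if coprime g n then 1 else 0) = (\<Sum>d | d dvd gcd g n. moebius_mu d)"
      using assms sum_moebius_mu_divisors[of "gcd g n"]
      by (metis coprime_iff_gcd_eq_1 gcd_pos_nat less_not_refl2)
    also have "\<dots> = (\<Sum>d | d dvd n. if d dvd g then moebius_mu d else 0)"
      using assms by (intro sum.mono_neutral_cong_left) auto
    finally show ?thesis .
  qed
  have "int (Phi k m n) = (\<Sum>A\<in>ksubsets k m n. if coprime (Gcd A) n then 1 else 0)"
    by (simp add: Phi_eq_card_coprime_Gcd sum.If_cases Int_def)
  also have "\<dots> = (\<Sum>d | d dvd n. \<Sum>A\<in>ksubsets k m n. if d dvd Gcd A then moebius_mu d else 0)"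
    unfolding coprime_sum by (rule sum.swap)
  also have "\<dots> = (\<Sum>d | d dvd n. moebius_mu d * int (card {A \<in> ksubsets k m n. d dvd Gcd A}))"
    by (intro sum.cong) (simp_all add: sum.If_cases Int_def mult.commute)
  also have "\<dots> = (\<Sum>d | d dvd n. moebius_mu d * int ((n div d - m div d) choose k))"
    using assms by (intro sum.cong) (auto simp: card_ksubsets_dvd_Gcd dest: dvd_pos_nat)
  finally show ?thesis .
qed

text \<open>Removing the \<open>m div q\<close> full blocks of length \<open>q\<close> from
  \<open>n\<close> leaves \<open>m mod q + (n - m)\<close>. As \<open>m mod q < q\<close>, the
  remainder of \<open>m\<close> adds at most one multiple, and the smaller divisor \<open>r\<close>
  only enlarges the quotient.\<close>

lemma multiples_count_le:
  fixes m n q r :: nat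
  assumes "q dvd n" "r \<le> q" "r > 0" "m < n"
  shows "n div q - m div q \<le> (n - m) div r + 1"
proof -
  have "n = (m mod q + (n - m)) + m div q * q"
    using \<open>m < n\<close> by (metis add.assoc add.commute div_mult_mod_eq le_add_diff_inverse less_imp_le)
  then have "n div q = (m mod q + (n - m)) div q + m div q"
    using assms by (metis div_mult_self1 leD add.commute)
  then have "n div q - m div q \<le> (m mod q + (n - m)) div q" by simp
  also have "\<dots> \<le> (q + (n - m)) div q"
    using assms by (intro div_le_mono add_right_mono less_imp_le mod_less_divisor) auto
  also have "\<dots> = (n - m) div q + 1"
    using assms by (subst div_add_self1) auto
  also have "\<dots> \<le> (n - m) div r + 1" using assms by (simp add: div_le_mono2)
  finally show ?thesis .
qed

lemma card_not_coprime_Gcd_bounds: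
  fixes k m n p :: nat
  assumes "m < n" and p: "prime p" "p dvd n"
    and least: "\<And>q. prime q \<Longrightarrow> q dvd n \<Longrightarrow> p \<le> q"
  defines "E \<equiv> int ((n - m) choose k) - int ((n div p - m div p) choose k) - int (Phi k m n)"
  shows "0 \<le> E" and "E \<le> int n * int (((n - m) div (p + 1) + 1) choose k)"
proof -
  let ?C = "{A \<in> ksubsets k m n. coprime (Gcd A) n}"
  let ?D = "\<lambda>q. {A \<in> ksubsets k m n. q dvd Gcd A}"
  let ?Q = "{q. prime q \<and> q dvd n \<and> q \<noteq> p}"
  let ?R = "ksubsets k m n - (?C \<union> ?D p)"
  \<comment> \<open>The prime \<open>p\<close> divides \<open>n\<close>, so it cannot also divide a
    \<open>Gcd A\<close> coprime to \<open>n\<close>. Hence the two cardinalities add, and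
    \<open>E\<close> counts exactly \<open>?R\<close>.\<close>
  have disj: "?C \<inter> ?D p = {}"
    using p by (auto dest: coprime_common_divisor not_prime_unit)
  have "card (?C \<union> ?D p) = Phi k m n + ((n div p - m div p) choose k)"
    using disj p by (simp add: card_Un_disjoint Phi_eq_card_coprime_Gcd card_ksubsets_dvd_Gcd prime_gt_0_nat)
  moreover have "card ?R = card (ksubsets k m n) - card (?C \<union> ?D p)"
    by (rule card_Diff_subset) auto
  moreover have "card (?C \<union> ?D p) \<le> card (ksubsets k m n)"
    by (rule card_mono) auto
  ultimately have E: "E = int (card ?R)"
    by (simp add: E_def card_ksubsets)
  then show "0 \<le> E" by simp
  have Q: "?Q \<subseteq> {1..n}"
    using \<open>m < n\<close> by (auto simp: Suc_le_eq prime_gt_0_nat dest: dvd_imp_le)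
  then have "finite ?Q" by (rule finite_subset) simp
  have "?R \<subseteq> (\<Union>q\<in>?Q. ?D q)"
  proof
    fix A assume A: "A \<in> ?R"
    then have "\<not> coprime (Gcd A) n" by blast
    then have "gcd (Gcd A) n \<noteq> 1" by (simp only: coprime_iff_gcd_eq_1 not_False_eq_True)
    then obtain q where q: "prime q" "q dvd gcd (Gcd A) n"
      using prime_factor_nat by blast
    then have "q dvd Gcd A" "q dvd n"
      using dvd_trans gcd_dvd1 gcd_dvd2 by blast+
    with A q(1) show "A \<in> (\<Union>q\<in>?Q. ?D q)" by blast
  qed
  then have "card ?R \<le> card (\<Union>q\<in>?Q. ?D q)"
    using \<open>finite ?Q\<close> by (intro card_mono) auto
  \<comment> \<open>One set may lie in \<open>?D q\<close> for several \<open>q\<close>, so this is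
    only a union bound.\<close>
  also have "\<dots> \<le> (\<Sum>q\<in>?Q. card (?D q))"
    using \<open>finite ?Q\<close> by (rule card_UN_le)
  also have "\<dots> \<le> (\<Sum>q\<in>?Q. ((n - m) div (p + 1) + 1) choose k)"
  proof (rule sum_mono)
    fix q assume "q \<in> ?Q"
    \<comment> \<open>Minimality of \<open>p\<close> together with \<open>q \<noteq> p\<close>
      yields the \<open>p + 1\<close> of the bound.\<close>
    then have q: "prime q" "q dvd n" "p + 1 \<le> q"
      using least[of q] by auto
    then have "card (?D q) = (n div q - m div q) choose k"
      by (simp add: card_ksubsets_dvd_Gcd prime_gt_0_nat)
    also have "\<dots> \<le> ((n - m) div (p + 1) + 1) choose k"
      using q \<open>m < n\<close> by (intro binomial_right_mono multiples_count_le) auto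
    finally show "card (?D q) \<le> ((n - m) div (p + 1) + 1) choose k" .
  qed
  \<comment> \<open>The factor \<open>n\<close> is the crude bound on \<open>card ?Q\<close> from
    \<open>?Q \<subseteq> {1..n}\<close>.\<close>
  also have "\<dots> \<le> n * (((n - m) div (p + 1) + 1) choose k)"
    using card_mono[OF _ Q] by (simp del: binomial_Suc_Suc)
  finally show "E \<le> int n * int (((n - m) div (p + 1) + 1) choose k)"
    unfolding E by (simp flip: of_nat_mult)
qed

theorem theorem4:
  fixes k m n :: nat
  assumes "m < n" and "k \<ge> 1"
  shows "int (Phi k m n) =
           (\<Sum>d | d dvd n. moebius_mu d *
              int ((n div d - nat \<lfloor>real m / real d\<rfloor>) choose k))
       \<and> (n \<ge> 2 \<longrightarrow>
           (let p = least_prime_divisor n;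
                E = int ((n - m) choose k)
                    - int ((n div p - nat \<lfloor>real m / real p\<rfloor>) choose k)
                    - int (Phi k m n)
            in 0 \<le> E \<and>
               E \<le> int n * int ((nat \<lfloor>real (n - m) / real (p + 1)\<rfloor> + 1) choose k)))"
proof -
  \<comment> \<open>At \<open>b = 0\<close> both sides take the default value 0.\<close>
  have floor: "nat \<lfloor>real a / real b\<rfloor> = a div b" for a b
    by (simp add: floor_divide_of_nat_eq)
  let ?p = "least_prime_divisor n"
  have p: "prime ?p" "?p dvd n" if "n \<ge> 2"
    using LeastI_ex[of "\<lambda>p. prime p \<and> p dvd n"] prime_factor_nat[of n] that
    unfolding least_prime_divisor_def by auto
  have least: "?p \<le> q" if "prime q" "q dvd n" for q
    unfolding least_prime_divisor_def using that by (simp add: Least_le)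
  show ?thesis
    unfolding floor Let_def
    using Phi_eq_sum_moebius_mu[of n k m] card_not_coprime_Gcd_bounds[OF assms(1) p least] assms(1)
    by blast
qed

end
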